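(* For $p\ge1$ let $\sigma_p$ be a probability measure on $\mathbb C^{d_p}$. Suppose there exist a constant $\rho>1$ and, for every $p\ge1$, constants $C_p'>0$ such that: (B1) for all $R\ge1$, $\ \sigma_p\big(\{a\in\mathbb C^{d_p}:\log\|a\|>R\}\big)\le \dfrac{C_p'}{R^\rho}$; (B2) for all $R\ge1$ and each unit vector $u\in\mathbb C^{d_p}$, $\ \sigma_p\big(\{a\in\mathbb C^{d_p}:\log|\langle a,u\rangle|<-R\}\big)\le\dfrac{C_p'}{R^\rho}$. Then for any constant $\nu$ with $1\le\nu<\rho$ there exist constants $C_p>0$, $p\ge1$, such that $$\int_{\mathbb C^{d_p}}\big|\log|\langle a,u\rangle|\,\big|^\nu\,d\sigma_p(a)\le C_p\quad\text{for any } u\in\mathbb C^{d_p}\text{ with }\|u\|=1 .$$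
   Context: $d_p\geq 1$ are integers (in the paper $d_p$ is the dimension of a Bergman space $H^0_{(2)}(X,L_p)\simeq\mathbb C^{d_p}$). $\langle a,u\rangle=\sum_j a_ju_j$, and $\|\cdot\|$ is the Euclidean norm. *)

theory Defs
  imports "HOL-Probability.Probability"
begin

text \<open>
  The dimension \<open>d\<^sub>p\<close> varies with \<open>p\<close>, so a vector of complex \<open>n\<close>-space is a function
  on \<open>nat\<close> with coordinates \<open>0, ..., n - 1\<close>, extensional (\<open>undefined\<close>) elsewhere.
\<close>

definition Cn :: "nat \<Rightarrow> (nat \<Rightarrow> complex) set" where
  "Cn n = {..<n} \<rightarrow>\<^sub>E UNIV"

text \<open>
  Since \<open>complex\<close> is second countable, the finite product sigma-algebra is the Borel
  sigma-algebra of complex \<open>n\<close>-space.  Its space is \<^term>\<open>Cn n\<close>.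
\<close>

definition borel_Cn :: "nat \<Rightarrow> (nat \<Rightarrow> complex) measure" where
  "borel_Cn n = Pi\<^sub>M {..<n} (\<lambda>_. borel)"

definition prob_on_Cn :: "nat \<Rightarrow> (nat \<Rightarrow> complex) measure \<Rightarrow> bool" where
  "prob_on_Cn n M \<longleftrightarrow> prob_space M \<and> sets M = sets (borel_Cn n)"

definition norm_Cn :: "nat \<Rightarrow> (nat \<Rightarrow> complex) \<Rightarrow> real" where
  "norm_Cn n a = L2_set (\<lambda>j. cmod (a j)) {..<n}"

text \<open>The pairing is bilinear: there is no complex conjugation.\<close>

definition pair_Cn :: "nat \<Rightarrow> (nat \<Rightarrow> complex) \<Rightarrow> (nat \<Rightarrow> complex) \<Rightarrow> complex" where
  "pair_Cn n a u = (\<Sum>j<n. a j * u j)"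

text \<open>
  The natural logarithm on \<open>[0, \<infinity>)\<close> with \<open>log 0 = -\<infinity>\<close>.  The library's \<^term>\<open>ln\<close> has
  \<open>ln 0 = 0\<close>, which would drop the hyperplane \<open>\<langle>a, u\<rangle> = 0\<close> both from the sublevel sets
  of \<open>log \<bar>\<langle>a, u\<rangle>\<bar>\<close> and from the integral.
\<close>

definition elog :: "real \<Rightarrow> ereal" where
  "elog x = (if x > 0 then ereal (ln x) else -\<infinity>)"

text \<open>Powers of elements of \<open>[0, \<infinity>]\<close>, with \<open>\<infinity>\<close> raised to a positive exponent being \<open>\<infinity>\<close>.\<close>

definition epowr :: "ereal \<Rightarrow> real \<Rightarrow> ennreal" where
  "epowr x r = (if x = \<infinity> then \<infinity> else ennreal (real_of_ereal x powr r))"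

end

theory Submission
  imports Defs
begin

text \<open>
  By Cauchy--Schwarz \<open>log \<bar>\<langle>a, u\<rangle>\<bar> \<le> log \<parallel>a\<parallel>\<close>, so both hypotheses together bound the tail
  of \<open>\<bar>log \<bar>\<langle>a, u\<rangle>\<bar>\<bar>\<close> by \<open>2 C' / R powr \<rho>\<close>.  Cutting the range of a function with such a tail
  at the levels \<open>2 ^ n\<close> dominates its \<open>\<nu>\<close>-th moment by a geometric series of ratio
  \<open>2 powr (\<nu> - \<rho>) < 1\<close>.
\<close>

text \<open>The summand 1 covers \<bar>x\<bar> \<le> 1. If 2^n < \<bar>x\<bar> \<le> 2^(n+1), the
  n-th term alone suffices: its indicator is 1 and its weight is the \<nu>-th power of the upper end
  of this shell. If x is infinite, all indicators are 1 and the series diverges.\<close>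

lemma epowr_abs_le_dyadic_sum:
  fixes x :: ereal and \<nu> :: real
  assumes "\<nu> \<ge> 0"
  shows "epowr \<bar>x\<bar> \<nu> \<le>
    1 + (\<Sum>n. ennreal (2 powr (real (Suc n) * \<nu>)) * indicator {y. ereal (2 ^ n) < \<bar>y\<bar>} x)"
    (is "_ \<le> 1 + (\<Sum>n. ?f n)")
proof (cases "\<bar>x\<bar> = \<infinity>")
  case True
  \<comment> \<open>Since \<nu> \<ge> 0, every weight is at least 1, so the first N terms already
    add up to at least N.\<close>
  have "of_nat N \<le> (\<Sum>n. ?f n)" for N
  proof -
    have "1 \<le> ?f n" for n
      using assms True by (simp add: ge_one_powr_ge_zero)
    then have "(\<Sum>n<N. 1) \<le> (\<Sum>n<N. ?f n)"
      by (intro sum_mono)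
    also have "\<dots> \<le> (\<Sum>n. ?f n)"
      by (intro sum_le_suminf) auto
    finally show ?thesis by simp
  qed
  then have "(\<Sum>n. ?f n) = top"
    using ennreal_Ex_less_of_nat[of "\<Sum>n. ?f n"] by (meson leD top.not_eq_extremum)
  then show ?thesis by simp
next
  case False
  then obtain r where r: "x = ereal r" by (cases x) auto
  have eq: "epowr \<bar>x\<bar> \<nu> = ennreal (\<bar>r\<bar> powr \<nu>)"
    by (simp add: r epowr_def)
  show ?thesis
  proof (cases "\<bar>r\<bar> \<le> 1")
    case True
    then have "\<bar>r\<bar> powr \<nu> \<le> 1"
      using assms by (intro powr_le1) auto
    then have "epowr \<bar>x\<bar> \<nu> \<le> 1" by (simp add: eq)
    also have "\<dots> \<le> 1 + (\<Sum>n. ?f n)" by simp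
    finally show ?thesis .
  next
    case False
    \<comment> \<open>The shell containing \<bar>r\<bar> is found by minimality: as \<bar>r\<bar> >
      1 = 2^0, the least m is a successor \<open>Suc n\<close>, and n itself fails, which gives 2^n
      < \<bar>r\<bar>.\<close>
    define m where "m = (LEAST m. \<bar>r\<bar> \<le> (2::real) ^ m)"
    have "\<exists>m. \<bar>r\<bar> \<le> (2::real) ^ m"
      using real_arch_pow[of 2 "\<bar>r\<bar>"] by (auto intro: less_imp_le)
    then have m: "\<bar>r\<bar> \<le> 2 ^ m" unfolding m_def by (rule LeastI_ex)
    with False obtain n where n: "m = Suc n" by (cases m) auto
    have lt: "2 ^ n < \<bar>r\<bar>"
      using not_less_Least[of n "\<lambda>m. \<bar>r\<bar> \<le> (2::real) ^ m"] n by (auto simp: m_def)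
    have "\<bar>r\<bar> powr \<nu> \<le> (2 ^ Suc n) powr \<nu>"
      using m n assms by (intro powr_mono2) auto
    also have "\<dots> = 2 powr (real (Suc n) * \<nu>)"
      by (metis powr_powr powr_realpow zero_less_numeral)
    finally have "epowr \<bar>x\<bar> \<nu> \<le> ?f n"
      using lt unfolding eq by (simp add: r ennreal_leI)
    also have "\<dots> = (\<Sum>i\<in>{n}. ?f i)"
      by (simp only: sum.insert sum.empty finite.emptyI empty_iff not_False_eq_True add_0_right)
    also have "\<dots> \<le> (\<Sum>i. ?f i)"
      by (intro sum_le_suminf) auto
    also have "\<dots> \<le> 1 + (\<Sum>i. ?f i)" by simp
    finally show ?thesis .
  qed
qed

text \<open>The pointwise dyadic bound is integrated term by term, and the tail hypothesis is
  applied at R = 2^n. Infinite values of X need no separate argument, since the dyadic bound holds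
  for them too.\<close>

lemma (in prob_space) nn_integral_epowr_abs_le:
  fixes X :: "'a \<Rightarrow> ereal" and K \<nu> \<rho> :: real
  assumes X [measurable]: "X \<in> borel_measurable M"
    and "0 \<le> \<nu>" "\<nu> < \<rho>" "0 \<le> K"
    and tail: "\<And>R. 1 \<le> R \<Longrightarrow> prob {a \<in> space M. ereal R < \<bar>X a\<bar>} \<le> K / R powr \<rho>"
  shows "(\<integral>\<^sup>+ a. epowr \<bar>X a\<bar> \<nu> \<partial>M) \<le> ennreal (1 + K * 2 powr \<nu> / (1 - 2 powr (\<nu> - \<rho>)))"
proof -
  \<comment> \<open>Ratio of the geometric series: weight times tail is 2^((n+1)\<nu>) K /
    2^(n\<rho>) = K 2^\<nu> q^n, and \<nu> < \<rho> makes q < 1.\<close>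
  define q where "q = (2::real) powr (\<nu> - \<rho>)"
  have q: "0 \<le> q" "q < 1"
    using \<open>\<nu> < \<rho>\<close> unfolding q_def by (auto simp: powr_less_one)
  have term_le: "ennreal (2 powr (real (Suc n) * \<nu>)) * emeasure M {a \<in> space M. ereal (2 ^ n) < \<bar>X a\<bar>}
      \<le> ennreal (K * 2 powr \<nu> * q ^ n)" for n
  proof -
    have "2 powr (real (Suc n) * \<nu>) * prob {a \<in> space M. ereal (2 ^ n) < \<bar>X a\<bar>}
        \<le> 2 powr (real (Suc n) * \<nu>) * (K / (2 ^ n) powr \<rho>)"
      by (intro mult_left_mono tail) auto
    also have "\<dots> = K * 2 powr \<nu> * q ^ n"
    proof -
      have "(2 ^ n) powr \<rho> = (2::real) powr (real n * \<rho>)"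
        by (metis powr_powr powr_realpow zero_less_numeral)
      moreover have "q ^ n = 2 powr (real n * \<nu> - real n * \<rho>)"
        by (simp add: q_def powr_power algebra_simps)
      moreover have "(2::real) powr (real (Suc n) * \<nu>) = 2 powr \<nu> * 2 powr (real n * \<nu>)"
        by (simp add: powr_add[symmetric] algebra_simps)
      ultimately show ?thesis by (simp add: powr_diff)
    qed
    finally show ?thesis
      by (simp add: emeasure_eq_measure ennreal_mult'[symmetric] ennreal_leI)
  qed
  \<comment> \<open>The indicator is pulled back from the values of X to a subset of
    \<open>space M\<close>, so that each term integrates to the left-hand side of
    \<open>term_le\<close>.\<close>
  have "(\<integral>\<^sup>+ a. epowr \<bar>X a\<bar> \<nu> \<partial>M) \<le> (\<integral>\<^sup>+ a. 1 + (\<Sum>n. ennreal (2 powr (real (Suc n) * \<nu>)) *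
      indicator {a \<in> space M. ereal (2 ^ n) < \<bar>X a\<bar>} a) \<partial>M)"
    using \<open>0 \<le> \<nu>\<close>
    by (intro nn_integral_mono order_trans[OF epowr_abs_le_dyadic_sum]) (auto simp: indicator_def)
  also have "\<dots> = 1 + (\<Sum>n. ennreal (2 powr (real (Suc n) * \<nu>)) *
      emeasure M {a \<in> space M. ereal (2 ^ n) < \<bar>X a\<bar>})"
    by (simp add: nn_integral_add nn_integral_suminf nn_integral_cmult emeasure_space_1)
  also have "\<dots> \<le> 1 + (\<Sum>n. ennreal (K * 2 powr \<nu> * q ^ n))"
    by (intro add_left_mono suminf_le term_le) auto
  also have "(\<Sum>n. ennreal (K * 2 powr \<nu> * q ^ n)) = ennreal (K * 2 powr \<nu> * (1 / (1 - q)))"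
    using q \<open>0 \<le> K\<close> by (intro suminf_ennreal_eq sums_mult geometric_sums) auto
  also have "1 + \<dots> = ennreal (1 + K * 2 powr \<nu> / (1 - q))"
    using q \<open>0 \<le> K\<close> by (simp)
  finally show ?thesis by (simp add: q_def)
qed

lemma elog_mono: "x \<le> y \<Longrightarrow> elog x \<le> elog y"
  by (auto simp: elog_def)

lemma cmod_pair_Cn_le: "cmod (pair_Cn n a u) \<le> norm_Cn n a * norm_Cn n u"
proof -
  have "cmod (pair_Cn n a u) \<le> (\<Sum>j<n. \<bar>cmod (a j)\<bar> * \<bar>cmod (u j)\<bar>)"
    unfolding pair_Cn_def by (rule order_trans[OF norm_sum]) (simp add: norm_mult)
  also have "\<dots> \<le> norm_Cn n a * norm_Cn n u"
    unfolding norm_Cn_def by (rule L2_set_mult_ineq)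
  finally show ?thesis .
qed

lemma borel_measurable_elog [measurable]: "elog \<in> borel_measurable borel"
  unfolding elog_def [abs_def] by measurable

lemma borel_measurable_norm_Cn [measurable]: "norm_Cn n \<in> borel_measurable (borel_Cn n)"
  unfolding norm_Cn_def [abs_def] L2_set_def borel_Cn_def by measurable

lemma borel_measurable_pair_Cn [measurable]:
  "(\<lambda>a. pair_Cn n a u) \<in> borel_measurable (borel_Cn n)"
  unfolding pair_Cn_def borel_Cn_def by measurable

lemma space_borel_Cn: "space (borel_Cn n) = Cn n"
  by (simp add: borel_Cn_def Cn_def space_PiM)

lemma prob_abs_elog_pair_Cn_le:
  assumes M: "prob_on_Cn n M" and u: "norm_Cn n u = 1"
    and upper: "measure M {a \<in> Cn n. elog (norm_Cn n a) > ereal R} \<le> b"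
    and lower: "measure M {a \<in> Cn n. elog (cmod (pair_Cn n a u)) < ereal (- R)} \<le> c"
  shows "measure M {a \<in> Cn n. ereal R < \<bar>elog (cmod (pair_Cn n a u))\<bar>} \<le> b + c"
    (is "measure M ?E \<le> _")
proof -
  interpret prob_space M using M by (simp add: prob_on_Cn_def)
  have sets [measurable_cong]: "sets M = sets (borel_Cn n)" using M by (simp add: prob_on_Cn_def)
  have sp: "Cn n = space M" using sets_eq_imp_space_eq[OF sets] by (simp add: space_borel_Cn)
  let ?A = "{a \<in> Cn n. elog (norm_Cn n a) > ereal R}"
  let ?B = "{a \<in> Cn n. elog (cmod (pair_Cn n a u)) < ereal (- R)}"
  have [measurable]: "?A \<in> events" "?B \<in> events" unfolding sp by measurable
  have "?E \<subseteq> ?A \<union> ?B"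
  proof
    fix a assume a: "a \<in> ?E"
    have "elog (cmod (pair_Cn n a u)) \<le> elog (norm_Cn n a)"
      using cmod_pair_Cn_le[of n a u] u by (intro elog_mono) simp
    \<comment> \<open>The value -\<infinity> falls under the second alternative, so the hyperplane
      where the pairing vanishes is charged to \<open>?B\<close>. In the first alternative the
      preceding inequality leads to \<open>?A\<close>.\<close>
    moreover have "ereal R < y \<or> y < ereal (- R)" if "ereal R < \<bar>y\<bar>" for y
      using that by (cases y) auto
    ultimately show "a \<in> ?A \<union> ?B" using a by (auto intro: less_le_trans)
  qed
  then have "prob ?E \<le> prob (?A \<union> ?B)" by (intro finite_measure_mono) auto
  also have "\<dots> \<le> prob ?A + prob ?B" by (rule measure_Un_le) auto
  finally show ?thesis using upper lower by linarith
qed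

theorem lemma4p14:
  fixes d :: "nat \<Rightarrow> nat"
    and \<sigma> :: "nat \<Rightarrow> (nat \<Rightarrow> complex) measure"
    and \<rho> :: real
    and C' :: "nat \<Rightarrow> real"
  assumes d: "\<And>p. p \<ge> 1 \<Longrightarrow> d p \<ge> 1"
    and \<sigma>: "\<And>p. p \<ge> 1 \<Longrightarrow> prob_on_Cn (d p) (\<sigma> p)"
    and \<rho>: "\<rho> > 1"
    and C': "\<And>p. p \<ge> 1 \<Longrightarrow> C' p > 0"
    and B1: "\<And>p R. p \<ge> 1 \<Longrightarrow> R \<ge> 1 \<Longrightarrow>
      measure (\<sigma> p) {a \<in> Cn (d p). elog (norm_Cn (d p) a) > ereal R} \<le> C' p / R powr \<rho>"
    and B2: "\<And>p R u. p \<ge> 1 \<Longrightarrow> R \<ge> 1 \<Longrightarrow> u \<in> Cn (d p) \<Longrightarrow> norm_Cn (d p) u = 1 \<Longrightarrow>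
      measure (\<sigma> p) {a \<in> Cn (d p). elog (cmod (pair_Cn (d p) a u)) < ereal (- R)} \<le> C' p / R powr \<rho>"
  shows "\<forall>\<nu>::real. 1 \<le> \<nu> \<and> \<nu> < \<rho> \<longrightarrow>
    (\<exists>C :: nat \<Rightarrow> real. \<forall>p\<ge>1. C p > 0 \<and>
      (\<forall>u \<in> Cn (d p). norm_Cn (d p) u = 1 \<longrightarrow>
        (\<integral>\<^sup>+ a. epowr \<bar>elog (cmod (pair_Cn (d p) a u))\<bar> \<nu> \<partial>(\<sigma> p)) \<le> ennreal (C p)))"
proof (intro allI impI, elim conjE)
  fix \<nu> :: real
  assume \<nu>: "1 \<le> \<nu>" "\<nu> < \<rho>"
  \<comment> \<open>This is the moment bound with K = 2 * C' p, one C' p for each of the two tails.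
    It does not involve u, which gives uniformity over unit vectors.\<close>
  define C where "C p = 1 + (2 * C' p) * 2 powr \<nu> / (1 - 2 powr (\<nu> - \<rho>))" for p
  have "C p > 0 \<and> (\<forall>u \<in> Cn (d p). norm_Cn (d p) u = 1 \<longrightarrow>
      (\<integral>\<^sup>+ a. epowr \<bar>elog (cmod (pair_Cn (d p) a u))\<bar> \<nu> \<partial>(\<sigma> p)) \<le> ennreal (C p))"
    if p: "p \<ge> 1" for p
  proof (intro conjI ballI impI)
    have "2 powr (\<nu> - \<rho>) < 1" using \<nu> by (simp add: powr_less_one)
    then show "C p > 0"
      using C'[OF p] unfolding C_def by (intro add_pos_nonneg divide_nonneg_pos) auto
  next
    fix u assume u: "u \<in> Cn (d p)" "norm_Cn (d p) u = 1"
    interpret prob_space "\<sigma> p" using \<sigma>[OF p] by (simp add: prob_on_Cn_def)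
    have sets [measurable_cong]: "sets (\<sigma> p) = sets (borel_Cn (d p))"
      using \<sigma>[OF p] by (simp add: prob_on_Cn_def)
    have sp: "space (\<sigma> p) = Cn (d p)"
      using sets_eq_imp_space_eq[OF sets] by (simp add: space_borel_Cn)
    show "(\<integral>\<^sup>+ a. epowr \<bar>elog (cmod (pair_Cn (d p) a u))\<bar> \<nu> \<partial>(\<sigma> p)) \<le> ennreal (C p)"
      unfolding C_def
    proof (rule nn_integral_epowr_abs_le)
      fix R :: real assume R: "1 \<le> R"
      show "prob {a \<in> space (\<sigma> p). ereal R < \<bar>elog (cmod (pair_Cn (d p) a u))\<bar>}
          \<le> 2 * C' p / R powr \<rho>"
        using prob_abs_elog_pair_Cn_le[OF \<sigma>[OF p] u(2) B1[OF p R] B2[OF p R u]]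
        by (simp add: sp)
    qed (use \<nu> C'[OF p] in \<open>auto intro: less_imp_le\<close>)
  qed
  then show "\<exists>C :: nat \<Rightarrow> real. \<forall>p\<ge>1. C p > 0 \<and> (\<forall>u \<in> Cn (d p). norm_Cn (d p) u = 1 \<longrightarrow>
      (\<integral>\<^sup>+ a. epowr \<bar>elog (cmod (pair_Cn (d p) a u))\<bar> \<nu> \<partial>(\<sigma> p)) \<le> ennreal (C p))"
    by blast
qed

end
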